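(* Let $\omega$ be a finite permutation of the positive integers and let $\mathcal T_\omega$ be its tower diagram. Then the reading map $T\mapsto\mathrm{Read}(T)$ is a bijection from the set $\mathrm{STT}(\mathcal T_\omega)$ of standard tower tableaux of shape $\mathcal T_\omega$ onto the set $\mathrm{Red}(\omega)$ of reduced words of $\omega$, with inverse $\alpha\mapsto R(\alpha)$ given by the SR algorithm.
   Context: $s_i$ denotes the adjacent transposition $(i,i+1)$ of the positive integers; a finite permutation is a bijection of the positive integers fixing all but finitely many points. A reduced word of $\omega$ is a word $\alpha_1\cdots\alpha_\ell$ of positive integers with $\omega=s_{\alpha_1}\cdots s_{\alpha_\ell}$ and $\ell$ minimal. A cell is a pair $(i,j)$ of integers with $i\ge 1$, $j\ge 0$. A tower diagram is a finite set $\mathcal T$ of cells such that $(i,j)\in\mathcal T$ and $0\le k\le j$ imply $(i,k)\in\mathcal T$. The cell $(i,j)$ lies on the diagonal $x+y=i+j$. Flight paths (recursive): a cell $(i,j)\in\mathcal T$ has a flight path in $\mathcal T$ if either (F1) there is no cell $(i',j')\in\mathcal T$ with $i'<i$ and $i'+j'=i+j-1$ (flight path $\{(i,j)\}$), or (F2) such cells exist and, letting $(i',j')$ be the one with largest $i'$, $(i',j')$ has a flight path and $(i',j'+1)\in\mathcal T$ (flight path $\{(i,j),(i',j'+1)\}\cup\mathrm{flightpath}((i',j'),\mathcal T)$). The flight number of such a cell is $a+b$ for $(a,b)$ the lexicographically smallest element of its flight path. A corner cell of $\mathcal T$ is a cell $(i,j)\in\mathcal T$ with $(i,j+1)\notin\mathcal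 T$ having a flight path. Sliding: for a positive integer $\alpha$, $\alpha^{\searrow}\mathcal T$ is computed by the procedure $P(\gamma,m)$ started at $\gamma=\alpha$, $m=1$: (S1) if no cell $(i,j)\in\mathcal T$ with $i\ge m$ lies on $x+y=\gamma-1$: (a) if $(\gamma,0)\notin\mathcal T$ the result is $\mathcal T\cup\{(\gamma,0)\}$; (b) if $(\gamma,0)\in\mathcal T$, $(\gamma,1)\notin\mathcal T$ the slide terminates (without result); (c) if $(\gamma,0),(\gamma,1)\in\mathcal T$, continue with $P(\gamma+1,\gamma+1)$. (S2) Otherwise let $i\ge m$ be smallest with $(i,\gamma-1-i)\in\mathcal T$: (a) if $(i,\gamma-i)\notin\mathcal T$ the result is $\mathcal T\cup\{(i,\gamma-i)\}$; (b) if $(i,\gamma-i)\in\mathcal T$, $(i,\gamma-i+1)\notin\mathcal T$ the slide terminates; (c) if both are in $\mathcal T$, continue with $P(\gamma+1,i+1)$. SR algorithm on a word $\alpha_1\cdots\alpha_n$: $\mathcal T^{(0)}=\varnothing$, $\mathcal T^{(k)}=\alpha_k^{\searrow}\mathcal T^{(k-1)}=\mathcal T^{(k-1)}\cup\{d_k\}$ (if no slide terminates); the recording tableau $R(\alpha)$ labels $d_k$ by $k$ and has shape $\mathcal T^{(n)}$. For a reduced word $\alpha$ the SR algorithm does not terminate, and the tower diagram $\mathcal T_\omega$ of $\omega$ is $\mathrm{shape}(R(\alpha))$ for any reduced word $\alpha$ of $\omega$ (independent of the choice). A standard tower tableau of shape $\mathcal T$ ($|\mathcal T|=n$) is a bijection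 $f:\mathcal T\to\{1,\dots,n\}$ such that for each $a$, $\mathcal T_{\le a}=f^{-1}(\{1,\dots,a\})$ is a tower diagram and $f^{-1}(a)$ is a corner cell of $\mathcal T_{\le a}$. Its reading word is $\mathrm{Read}(f)=\alpha_1\cdots\alpha_n$ with $\alpha_k$ the flight number of $f^{-1}(k)$ in $\mathcal T_{\le k}$. *)

theory Defs
  imports "HOL-Combinatorics.Permutations" "HOL-Library.Product_Lexorder"
begin

text \<open>
  A permutation of the positive integers is encoded as a function on \<^typ>\<open>nat\<close> that permutes
  \<open>{1..}\<close>, hence fixes \<open>0\<close>.
\<close>

definition finite_permutation :: "(nat \<Rightarrow> nat) \<Rightarrow> bool" where
  "finite_permutation w \<longleftrightarrow> w permutes {1..} \<and> finite {x. w x \<noteq> x}"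

definition word_perm :: "nat list \<Rightarrow> nat \<Rightarrow> nat" where
  "word_perm \<alpha> = foldr (\<lambda>a p. transpose a (a + 1) \<circ> p) \<alpha> id"

definition word_of :: "(nat \<Rightarrow> nat) \<Rightarrow> nat list \<Rightarrow> bool" where
  "word_of w \<alpha> \<longleftrightarrow> (\<forall>a\<in>set \<alpha>. 1 \<le> a) \<and> word_perm \<alpha> = w"

definition Red :: "(nat \<Rightarrow> nat) \<Rightarrow> nat list set" where
  "Red w = {\<alpha>. word_of w \<alpha> \<and> (\<forall>\<beta>. word_of w \<beta> \<longrightarrow> length \<alpha> \<le> length \<beta>)}"


type_synonym cell = "nat \<times> nat"

definition tower_diagram :: "cell set \<Rightarrow> bool" where
  "tower_diagram T \<longleftrightarrow> finite T \<and> (\<forall>(i, j)\<in>T. 1 \<le> i \<and> (\<forall>k\<le>j. (i, k) \<in> T))"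

text \<open>
  The relation \<open>is_flight_path T c F\<close> says that \<open>c\<close> has a flight path in \<open>T\<close> and that this path
  is \<open>F\<close>. The condition \<open>i' + j' = i + j - 1\<close> is written without subtraction.
\<close>

inductive is_flight_path :: "cell set \<Rightarrow> cell \<Rightarrow> cell set \<Rightarrow> bool" for T :: "cell set" where
  F1: "is_flight_path T (i, j) {(i, j)}"
    if "(i, j) \<in> T"
      and "\<not> (\<exists>i' j'. (i', j') \<in> T \<and> i' < i \<and> i' + j' + 1 = i + j)"
| F2: "is_flight_path T (i, j) ({(i, j), (i', j' + 1)} \<union> F)"
    if "(i, j) \<in> T"
      and "(i', j') \<in> T" and "i' < i" and "i' + j' + 1 = i + j"
      and "\<forall>k l. (k, l) \<in> T \<and> k < i \<and> k + l + 1 = i + j \<longrightarrow> k \<le> i'"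
      and "is_flight_path T (i', j') F"
      and "(i', j' + 1) \<in> T"

definition has_flight_path :: "cell set \<Rightarrow> cell \<Rightarrow> bool" where
  "has_flight_path T c \<longleftrightarrow> (\<exists>F. is_flight_path T c F)"

definition flight_path :: "cell set \<Rightarrow> cell \<Rightarrow> cell set" where
  "flight_path T c = (THE F. is_flight_path T c F)"

text \<open>The minimum is with respect to the lexicographic order on pairs.\<close>

definition flight_number :: "cell set \<Rightarrow> cell \<Rightarrow> nat" where
  "flight_number T c = (let (a, b) = Min (flight_path T c) in a + b)"

definition corner_cell :: "cell set \<Rightarrow> cell \<Rightarrow> bool" where
  "corner_cell T c \<longleftrightarrow> c \<in> T \<and> (fst c, snd c + 1) \<notin> T \<and> has_flight_path T c"


text \<open>
  \<open>slide_from T \<gamma> m\<close> is the procedure \<open>P(\<gamma>, m)\<close>. It returns \<open>Some d\<close> if the result is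
  \<open>T \<union> {d}\<close>, and \<open>None\<close> if the slide terminates without result. Each recursive call
  needs a cell of \<open>T\<close> on the diagonal \<open>x + y = \<gamma>\<close> and increases \<open>\<gamma>\<close>, so
  the recursion ends for every finite \<open>T\<close>. The guard \<open>i < \<gamma>\<close> keeps the
  subtractions exact.
\<close>

partial_function (option) slide_from :: "cell set \<Rightarrow> nat \<Rightarrow> nat \<Rightarrow> cell option" where
  "slide_from T \<gamma> m =
    (if \<not> (\<exists>i\<ge>m. i < \<gamma> \<and> (i, \<gamma> - 1 - i) \<in> T) then
       if (\<gamma>, 0) \<notin> T then Some (\<gamma>, 0)
       else if (\<gamma>, 1) \<notin> T then None
       else slide_from T (\<gamma> + 1) (\<gamma> + 1)
     else
       let i = (LEAST i. m \<le> i \<and> i < \<gamma> \<and> (i, \<gamma> - 1 - i) \<in> T) in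
       if (i, \<gamma> - i) \<notin> T then Some (i, \<gamma> - i)
       else if (i, \<gamma> - i + 1) \<notin> T then None
       else slide_from T (\<gamma> + 1) (i + 1))"

definition slide_cell :: "nat \<Rightarrow> cell set \<Rightarrow> cell option" where
  "slide_cell \<alpha> T = slide_from T \<alpha> 1"


text \<open>
  A tableau is a partial map from cells to labels; its shape is its domain.
\<close>

type_synonym tableau = "cell \<rightharpoonup> nat"

text \<open>
  \<open>SR_from f k \<alpha>\<close> continues the SR algorithm from the recording tableau \<open>f\<close> of the letters
  already processed, where \<open>k\<close> is the next label. The result is \<open>None\<close> if some slide
  terminates.
\<close>

primrec SR_from :: "tableau \<Rightarrow> nat \<Rightarrow> nat list \<Rightarrow> tableau option" where
  "SR_from f k [] = Some f"
| "SR_from f k (a # \<alpha>) =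
    (case slide_cell a (dom f) of
       None \<Rightarrow> None
     | Some d \<Rightarrow> SR_from (f(d \<mapsto> k)) (k + 1) \<alpha>)"

definition recording_tableau :: "nat list \<Rightarrow> tableau option" where
  "recording_tableau \<alpha> = SR_from Map.empty 1 \<alpha>"

definition tower_diagram_of :: "(nat \<Rightarrow> nat) \<Rightarrow> cell set" where
  "tower_diagram_of w = dom (the (recording_tableau (SOME \<alpha>. \<alpha> \<in> Red w)))"


definition cell_at :: "tableau \<Rightarrow> nat \<Rightarrow> cell" where
  "cell_at f a = (THE c. f c = Some a)"

definition cells_upto :: "tableau \<Rightarrow> nat \<Rightarrow> cell set" where
  "cells_upto f a = {c. \<exists>b\<in>{1..a}. f c = Some b}"

definition STT :: "cell set \<Rightarrow> tableau set" where
  "STT T = {f. dom f = T \<and> bij_betw (\<lambda>c. the (f c)) T {1..card T} \<and>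
     (\<forall>a\<in>{1..card T}.
        tower_diagram (cells_upto f a) \<and> corner_cell (cells_upto f a) (cell_at f a))}"

definition Read :: "tableau \<Rightarrow> nat list" where
  "Read f = map (\<lambda>k. flight_number (cells_upto f k) (cell_at f k)) [1..<card (dom f) + 1]"

end

theory Submission
  imports Defs
begin

text \<open>
  A tower diagram is determined by its column heights, and the slide can be run column by column.
  A flight path retraces the slide that created its starting corner from right to left, so removing
  a corner and sliding its flight number back in are inverse operations; hence \<open>Read\<close> and the SR
  algorithm are mutually inverse on all words whose slides do not terminate. The heights form the
  Lehmer code of the inverse permutation: the slide of \<open>\<alpha>\<close> into the diagram of \<open>w\<close> succeeds iff
  \<open>w \<alpha> < w (\<alpha> + 1)\<close>, and it then adds the cell on top of column \<open>w \<alpha>\<close>, giving the diagram of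
  \<open>w s\<^sub>\<alpha>\<close>. Thus the number of cells is the length of \<open>w\<close>, the words accepted by the SR algorithm
  are the reduced ones, and the diagram determines the permutation.
\<close>

subsection \<open>Slides column by column\<close>

text \<open>Column heights as a single function. Column 0 exists in this encoding, so lemmas about
  genuine tower diagrams assume \<open>h 0 = 0\<close>.\<close>

definition diagram :: "(nat \<Rightarrow> nat) \<Rightarrow> cell set" where
  "diagram h = {(i, j). j < h i}"

lemma mem_diagram [simp]: "(i, j) \<in> diagram h \<longleftrightarrow> j < h i"
  by (simp add: diagram_def)

lemma insert_diagram: "insert (p, h p) (diagram h) = diagram (h(p := Suc (h p)))"
  by (auto simp: diagram_def less_Suc_eq split: if_splits)

text \<open>Each column is a finite down-closed set of naturals, hence an initial segment whose
  length is its cardinality.\<close>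

lemma tower_diagram_imp_diagram:
  assumes "tower_diagram T"
  obtains h where "T = diagram h" "h 0 = 0"
proof -
  define h where "h i = card {j. (i, j) \<in> T}" for i
  have "{j. (i, j) \<in> T} = {..<h i}" for i
  proof -
    have fin: "finite {j. (i, j) \<in> T}"
      using assms finite_vimageI[of T "Pair i"] by (auto simp: tower_diagram_def vimage_def inj_on_def)
    have down: "(i, k) \<in> T" if "(i, j) \<in> T" "k \<le> j" for j k
      using assms that by (fastforce simp: tower_diagram_def)
    show ?thesis
    proof (cases "{j. (i, j) \<in> T} = {}")
      case True
      then show ?thesis by (simp add: h_def)
    next
      case False
      define M where "M = Max {j. (i, j) \<in> T}"
      have "M \<in> {j. (i, j) \<in> T}"
        unfolding M_def using fin False by (rule Max_in)
      moreover have "j \<le> M" if "(i, j) \<in> T" for j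
        unfolding M_def using fin that by auto
      ultimately have "{j. (i, j) \<in> T} = {..M}"
        unfolding atMost_def using down by blast
      then show ?thesis
        by (simp only: h_def card_atMost lessThan_Suc_atMost)
    qed
  qed
  then have "T = diagram h"
    by (auto simp: diagram_def)
  moreover have "(0, j) \<notin> T" for j
    using assms by (force simp: tower_diagram_def)
  then have "h 0 = 0"
    by (simp add: h_def)
  ultimately show thesis
    using that by blast
qed

text \<open>Column \<open>m\<close> ends below the diagonal \<open>x + y = \<gamma> - 1\<close>, so
  the search for the first hit may skip it.\<close>

lemma slide_from_pass:
  assumes "h m + m < \<gamma>"
  shows "slide_from (diagram h) \<gamma> m = slide_from (diagram h) \<gamma> (Suc m)"
proof -
  have "m \<le> i \<and> i < \<gamma> \<and> \<gamma> - 1 - i < h i \<longleftrightarrow> Suc m \<le> i \<and> i < \<gamma> \<and> \<gamma> - 1 - i < h i" for i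
    using assms by (cases "i = m") auto
  then have "(\<lambda>i. m \<le> i \<and> i < \<gamma> \<and> (i, \<gamma> - 1 - i) \<in> diagram h) =
      (\<lambda>i. Suc m \<le> i \<and> i < \<gamma> \<and> (i, \<gamma> - 1 - i) \<in> diagram h)"
    by (intro ext) (simp only: mem_diagram)
  then show ?thesis
    by (subst (1 2) slide_from.simps) (simp only:)
qed

text \<open>The first empty place of column \<open>m\<close> lies on the diagonal
  \<open>h m + m\<close>; comparing this with \<open>\<gamma>\<close> separates cases (a), (b), (c).
  For \<open>m = \<gamma>\<close> the search range is empty and (S1) applies, with the same outcome
  as (S2).\<close>

lemma slide_from_hit:
  assumes "m \<le> \<gamma>" "\<gamma> \<le> h m + m"
  shows "slide_from (diagram h) \<gamma> m =
    (if h m + m = \<gamma> then Some (m, h m)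
     else if h m + m = Suc \<gamma> then None
     else slide_from (diagram h) (Suc \<gamma>) (Suc m))"
proof (cases "m = \<gamma>")
  case True
  then show ?thesis
    by (subst slide_from.simps) auto
next
  case False
  then have *: "m \<le> m \<and> m < \<gamma> \<and> (m, \<gamma> - 1 - m) \<in> diagram h"
    using assms by auto
  then have "(LEAST i. m \<le> i \<and> i < \<gamma> \<and> (i, \<gamma> - 1 - i) \<in> diagram h) = m"
    by (intro Least_equality) auto
  moreover have "\<exists>i\<ge>m. i < \<gamma> \<and> (i, \<gamma> - 1 - i) \<in> diagram h"
    using * by blast
  ultimately show ?thesis
    using assms False by (subst slide_from.simps) (auto simp: Let_def)
qed

text \<open>
  \<open>slide_reaches h \<alpha> m \<gamma>\<close>: the slide of \<open>\<alpha>\<close> passes all columns left of \<open>m\<close> and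
  arrives at column \<open>m\<close> on the diagonal \<open>x + y = \<gamma>\<close>.
\<close>

inductive slide_reaches :: "(nat \<Rightarrow> nat) \<Rightarrow> nat \<Rightarrow> nat \<Rightarrow> nat \<Rightarrow> bool" for h \<alpha> where
  start: "slide_reaches h \<alpha> 1 \<alpha>"
| pass: "slide_reaches h \<alpha> (Suc m) \<gamma>" if "slide_reaches h \<alpha> m \<gamma>" "h m + m < \<gamma>"
| zigzag: "slide_reaches h \<alpha> (Suc m) (Suc \<gamma>)" if "slide_reaches h \<alpha> m \<gamma>" "\<gamma> + 2 \<le> h m + m"

lemma slide_reaches_le:
  assumes "slide_reaches h \<alpha> m \<gamma>" "1 \<le> \<alpha>"
  shows "1 \<le> m \<and> m \<le> \<gamma>"
  using assms by induction auto

lemma slide_reaches_slide_from: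
  assumes "slide_reaches h \<alpha> m \<gamma>" "1 \<le> \<alpha>"
  shows "slide_cell \<alpha> (diagram h) = slide_from (diagram h) \<gamma> m"
  using assms
proof induction
  case start
  then show ?case by (simp add: slide_cell_def)
next
  case (pass m \<gamma>)
  then show ?case by (simp add: slide_from_pass)
next
  case (zigzag m \<gamma>)
  then show ?case
    using slide_reaches_le[of h \<alpha> m \<gamma>] by (simp add: slide_from_hit)
qed

text \<open>Arrival at column \<open>m\<close> depends only on the columns to its left. This allows
  a cell to be added to or removed from column \<open>m\<close> itself.\<close>

lemma slide_reaches_cong:
  assumes "slide_reaches h \<alpha> m \<gamma>" "\<And>i. i < m \<Longrightarrow> h i = h' i"
  shows "slide_reaches h' \<alpha> m \<gamma>"
  using assms by induction (auto intro: slide_reaches.intros slide_reaches.start[unfolded One_nat_def])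

lemma slide_reaches_pass_many:
  assumes "slide_reaches h \<alpha> m \<gamma>" "m \<le> i" "\<And>k. m \<le> k \<Longrightarrow> k < i \<Longrightarrow> h k + k < \<gamma>"
  shows "slide_reaches h \<alpha> i \<gamma>"
  using assms(2,1,3) by (induction rule: dec_induct) (auto intro: slide_reaches.pass)

subsection \<open>Flight paths are reversed slides\<close>

lemma is_flight_path_start:
  assumes "is_flight_path T c F"
  shows "finite F" "c \<in> F" "c \<in> T"
  using assms by (induction, auto)

text \<open>(F1) and (F2) exclude each other, and in (F2) the previous cell is determined by its
  maximal column and its diagonal.\<close>

lemma is_flight_path_unique:
  assumes "is_flight_path T c F" "is_flight_path T c G"
  shows "F = G"
  using assms
proof (induction arbitrary: G)
  case (F1 i j)
  from F1(3,1,2) show ?case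
    by cases auto
next
  case (F2 i j i' j' F)
  from F2.prems show ?case
  proof cases
    case F1
    then show ?thesis using F2.hyps by auto
  next
    case (F2 k l F')
    have "k = i'"
      using F2 F2.hyps \<open>\<forall>k l. (k, l) \<in> T \<and> k < i \<and> k + l + 1 = i + j \<longrightarrow> k \<le> i'\<close>
      by (meson antisym)
    moreover from this have "l = j'"
      using \<open>k + l + 1 = i + j\<close> \<open>i' + j' + 1 = i + j\<close> by simp
    ultimately show ?thesis
      using F2 F2.IH by auto
  qed
qed

lemma flight_path_eq: "is_flight_path T c F \<Longrightarrow> flight_path T c = F"
  unfolding flight_path_def by (rule the_equality) (assumption, rule is_flight_path_unique)

text \<open>Both new cells are lexicographically above \<open>(i', j')\<close>, so a cell inherits
  the flight number of its predecessor.\<close>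

lemma Min_flight_path_step:
  fixes i i' j j' :: nat
  assumes "finite F" "(i', j') \<in> F" "i' < i"
  shows "Min ({(i, j), (i', j' + 1)} \<union> F) = Min F"
proof -
  have "Min F \<le> (i', j')"
    using assms by auto
  also have "(i', j') \<le> (i', j' + 1)"
    by simp
  finally have *: "Min F \<le> (i', j' + 1)" .
  also have "(i', j' + 1) \<le> (i, j)"
    using assms by simp
  finally have "Min F \<le> (i, j)" .
  with * show ?thesis
    using assms by (intro Min_eqI) (auto intro: Min_in)
qed

text \<open>(F1) describes a slide that passes every column left of \<open>i\<close>. In (F2) the
  cells \<open>(i', j')\<close> and \<open>(i', j' + 1)\<close> make the slide zigzag at column
  \<open>i'\<close>, and maximality of \<open>i'\<close> makes it pass all columns from there to
  \<open>i\<close>.\<close>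

lemma flight_path_imp_slide_reaches:
  assumes "is_flight_path (diagram h) (i, j) F" "h 0 = 0"
  shows "\<exists>\<alpha>\<ge>1. slide_reaches h \<alpha> i (i + j) \<and> (case Min F of (a, b) \<Rightarrow> a + b) = \<alpha>"
  using assms
proof (induction "(i, j)" F arbitrary: i j rule: is_flight_path.induct)
  case (F1 i j)
  have "1 \<le> i"
    using F1 by (cases i) auto
  moreover have "h k + k < i + j" if "k < i" for k
  proof (rule ccontr)
    assume "\<not> ?thesis"
    then have "(k, i + j - 1 - k) \<in> diagram h" "k < i" "k + (i + j - 1 - k) + 1 = i + j"
      using that by auto
    then show False
      using F1(2) by blast
  qed
  ultimately show ?case
    using slide_reaches_pass_many[OF slide_reaches.start, of i h "i + j"] by auto
next
  case (F2 i j i' j' F)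
  then obtain \<alpha> where \<alpha>: "1 \<le> \<alpha>" "slide_reaches h \<alpha> i' (i' + j')"
    "(case Min F of (a, b) \<Rightarrow> a + b) = \<alpha>"
    by blast
  have "slide_reaches h \<alpha> (Suc i') (i + j)"
    using slide_reaches.zigzag[OF \<alpha>(2)] F2 by auto
  moreover have "h k + k < i + j" if "Suc i' \<le> k" "k < i" for k
  proof (rule ccontr)
    assume "\<not> ?thesis"
    then have "(k, i + j - 1 - k) \<in> diagram h" "k < i" "k + (i + j - 1 - k) + 1 = i + j"
      using that by auto
    then have "k \<le> i'"
      using F2(5) by blast
    then show False
      using that by simp
  qed
  ultimately have "slide_reaches h \<alpha> i (i + j)"
    using F2(3) Suc_leI slide_reaches_pass_many by blast
  moreover have "Min ({(i, j), (i', j' + 1)} \<union> F) = Min F"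
    using is_flight_path_start[OF F2(6)] F2(3) by (intro Min_flight_path_step)
  ultimately show ?case
    using \<alpha> by auto
qed

text \<open>The column \<open>i\<close> stands for the next one that the slide hits after
  \<open>m\<close>. Keeping it general lets a pass reduce to the induction hypothesis at the same
  \<open>i\<close>, while a zigzag produces (F2).\<close>

lemma slide_reaches_imp_flight_path:
  assumes "slide_reaches h \<alpha> m \<gamma>" "1 \<le> \<alpha>" "h 0 = 0"
    and "m \<le> i" "i \<le> \<gamma>" "\<gamma> - i < h i" "\<And>k. m \<le> k \<Longrightarrow> k < i \<Longrightarrow> h k + k < \<gamma>"
  shows "\<exists>F. is_flight_path (diagram h) (i, \<gamma> - i) F \<and> (case Min F of (a, b) \<Rightarrow> a + b) = \<alpha>"
  using assms
proof (induction arbitrary: i)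
  case start
  have "\<not> (\<exists>i' j'. (i', j') \<in> diagram h \<and> i' < i \<and> i' + j' + 1 = i + (\<alpha> - i))"
  proof safe
    fix i' j'
    assume *: "(i', j') \<in> diagram h" "i' < i" "i' + j' + 1 = i + (\<alpha> - i)"
    then have "1 \<le> i'"
      using \<open>h 0 = 0\<close> by (cases i') auto
    then have "h i' + i' < \<alpha>"
      using start * by blast
    then show False
      using * start by auto
  qed
  then have "is_flight_path (diagram h) (i, \<alpha> - i) {(i, \<alpha> - i)}"
    using start by (intro is_flight_path.F1) auto
  then show ?case
    using start by (intro exI[of _ "{(i, \<alpha> - i)}"]) auto
next
  case (pass m \<gamma>)
  show ?case
  proof (rule pass.IH)
    show "h k + k < \<gamma>" if "m \<le> k" "k < i" for k
      using pass that by (cases "k = m") auto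
  qed (use pass in auto)
next
  case (zigzag m \<gamma>)
  have le: "1 \<le> m" "m \<le> \<gamma>"
    using slide_reaches_le[of h \<alpha> m \<gamma>] zigzag by auto
  \<comment> \<open>The zigzag column is itself a column that the slide hits, so the hypothesis
    applies with \<open>i = m\<close>.\<close>
  have "\<exists>F. is_flight_path (diagram h) (m, \<gamma> - m) F \<and> (case Min F of (a, b) \<Rightarrow> a + b) = \<alpha>"
    using zigzag le by (intro zigzag.IH) auto
  then obtain F where F: "is_flight_path (diagram h) (m, \<gamma> - m) F"
    "(case Min F of (a, b) \<Rightarrow> a + b) = \<alpha>"
    by blast
  let ?G = "{(i, Suc \<gamma> - i), (m, \<gamma> - m + 1)} \<union> F"
  have "is_flight_path (diagram h) (i, Suc \<gamma> - i) ?G"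
  proof (rule is_flight_path.F2)
    show "\<forall>k l. (k, l) \<in> diagram h \<and> k < i \<and> k + l + 1 = i + (Suc \<gamma> - i) \<longrightarrow> k \<le> m"
    proof safe
      fix k l
      assume *: "(k, l) \<in> diagram h" "k < i" "k + l + 1 = i + (Suc \<gamma> - i)"
      then have "Suc \<gamma> \<le> h k + k"
        using zigzag by auto
      moreover have "h k + k < Suc \<gamma>" if "Suc m \<le> k"
        using zigzag that * by blast
      ultimately show "k \<le> m"
        by (meson not_less_eq_eq not_less)
    qed
  qed (use zigzag le F in auto)
  moreover have "Min ?G = Min F"
    using is_flight_path_start[OF F(1)] zigzag by (intro Min_flight_path_step) auto
  ultimately show ?case
    using F(2) by metis
qed

text \<open>The slide arrives on the diagonal of the first empty place of column \<open>p\<close>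
  and fills it. Columns to the left are untouched, so the same slide still arrives there in the
  larger diagram, and the flight path of the new cell retraces it.\<close>

lemma slide_reaches_top:
  assumes "slide_reaches h \<alpha> p (h p + p)" "1 \<le> \<alpha>" "h 0 = 0"
  shows "slide_cell \<alpha> (diagram h) = Some (p, h p)"
    and "corner_cell (insert (p, h p) (diagram h)) (p, h p)"
    and "flight_number (insert (p, h p) (diagram h)) (p, h p) = \<alpha>"
proof -
  have le: "1 \<le> p"
    using slide_reaches_le[OF assms(1,2)] by simp
  show "slide_cell \<alpha> (diagram h) = Some (p, h p)"
    by (simp add: slide_reaches_slide_from[OF assms(1,2)] slide_from_hit)
  define h' where "h' = h(p := Suc (h p))"
  have "slide_reaches h' \<alpha> p (h p + p)"
    using assms(1) by (rule slide_reaches_cong) (simp add: h'_def)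
  then have "\<exists>F. is_flight_path (diagram h') (p, h p + p - p) F
      \<and> (case Min F of (a, b) \<Rightarrow> a + b) = \<alpha>"
    using assms le by (intro slide_reaches_imp_flight_path[where m = p]) (auto simp: h'_def)
  then obtain F where F: "is_flight_path (diagram h') (p, h p) F"
      "(case Min F of (a, b) \<Rightarrow> a + b) = \<alpha>"
    by auto
  then show "corner_cell (insert (p, h p) (diagram h)) (p, h p)"
    unfolding insert_diagram corner_cell_def has_flight_path_def by (auto simp: h'_def)
  show "flight_number (insert (p, h p) (diagram h)) (p, h p) = \<alpha>"
    using F flight_path_eq[OF F(1)]
    unfolding insert_diagram flight_number_def h'_def[symmetric] by simp
qed

text \<open>The flight path of the corner gives a slide arriving at its column. Deleting the corner
  changes nothing to the left, so this slide arrives at the place just vacated.\<close>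

lemma corner_cell_slide:
  assumes "tower_diagram T" "corner_cell T d"
  shows "1 \<le> flight_number T d" "slide_cell (flight_number T d) (T - {d}) = Some d"
proof -
  obtain h where h: "T = diagram h" "h 0 = 0"
    using assms(1) by (rule tower_diagram_imp_diagram)
  obtain p q where d: "d = (p, q)"
    by fastforce
  have q: "h p = Suc q"
    using assms(2) by (auto simp: corner_cell_def h d)
  define h' where "h' = h(p := q)"
  have T: "T - {d} = diagram h'"
    using q by (auto simp: h d h'_def diagram_def less_Suc_eq split: if_splits)
  obtain F where F: "is_flight_path (diagram h) (p, q) F"
    using assms(2) by (auto simp: corner_cell_def has_flight_path_def h d)
  then have "\<exists>\<alpha>\<ge>1. slide_reaches h \<alpha> p (p + q) \<and> flight_number T d = \<alpha>"
    using flight_path_imp_slide_reaches[OF F h(2)] flight_path_eq[OF F]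
    by (auto simp: flight_number_def h d)
  then have a: "1 \<le> flight_number T d" and "slide_reaches h (flight_number T d) p (p + q)"
    by auto
  then have "slide_reaches h' (flight_number T d) p (h' p + p)"
    using slide_reaches_cong[of h _ p "p + q" h'] by (auto simp: h'_def add.commute)
  moreover have "h' 0 = 0"
    using h(2) q by (cases "p = 0") (auto simp: h'_def)
  ultimately have "slide_cell (flight_number T d) (diagram h') = Some (p, h' p)"
    using a by (intro slide_reaches_top(1))
  then show "slide_cell (flight_number T d) (T - {d}) = Some d"
    unfolding T by (simp add: d h'_def)
  show "1 \<le> flight_number T d"
    by (rule a)
qed

subsection \<open>The code of a permutation\<close>

text \<open>This is the Lehmer code of the inverse of \<open>w\<close>.\<close>

definition code :: "(nat \<Rightarrow> nat) \<Rightarrow> nat \<Rightarrow> nat" where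
  "code w i = card {x. x < inv w i \<and> i < w x}"

context
  fixes w :: "nat \<Rightarrow> nat"
  assumes w: "finite_permutation w"
begin

lemma finite_permutation_bij: "bij w" and finite_permutation_0: "w 0 = 0"
  using w by (auto simp: finite_permutation_def permutes_bij permutes_not_in)

lemma finite_permutation_inv: "inv w (w x) = x" "w (inv w x) = x"
  using finite_permutation_bij by (simp_all add: bij_is_inj surj_f_inv_f bij_is_surj)

lemma finite_permutation_eq: "w x = w y \<longleftrightarrow> x = y"
  using finite_permutation_inv by metis

text \<open>Inversions are counted by their right position \<open>x\<close>.\<close>

lemma code_apply: "code w (w x) = card {y. y < x \<and> w x < w y}"
  by (simp add: code_def finite_permutation_inv)

lemma code_0: "code w 0 = 0"
  using code_apply[of 0] by (simp add: finite_permutation_0)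

text \<open>Past a bound \<open>N\<close> of the support no position is the right end of an
  inversion, so both the nonempty columns and their heights are bounded.\<close>

lemma tower_diagram_code: "tower_diagram (diagram (code w))"
proof -
  have "finite {x. w x \<noteq> x}"
    using w by (simp add: finite_permutation_def)
  then obtain N where N: "\<And>x. w x \<noteq> x \<Longrightarrow> x < N"
    unfolding finite_nat_set_iff_bounded by blast
  have code: "code w i \<le> N \<and> (N \<le> i \<longrightarrow> code w i = 0)" for i
  proof -
    obtain x where i: "i = w x"
      using finite_permutation_inv by metis
    \<comment> \<open>For \<open>x \<ge> N\<close> the value \<open>w y\<close> would be a fixed
      point, forcing \<open>w y = y < x = w x\<close>.\<close>
    have x: "x < N" if "y < x" "w x < w y" for y
    proof (rule ccontr)
      assume "\<not> x < N"
      then have "w x = x"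
        using N by blast
      then have "N \<le> w y"
        using that \<open>\<not> x < N\<close> by linarith
      then have "w (w y) = w y"
        using N leD by blast
      then show False
        using that \<open>w x = x\<close> finite_permutation_eq by auto
    qed
    show ?thesis
    proof (cases "x < N")
      case True
      have "code w i \<le> card {..<x}"
        unfolding i code_apply by (rule card_mono) auto
      moreover have "i < N"
      proof (rule ccontr)
        assume "\<not> i < N"
        then have "w i = i"
          using N by blast
        then show False
          using True \<open>\<not> i < N\<close> finite_permutation_eq[of i x] by (simp add: i)
      qed
      ultimately show ?thesis
        using True by simp
    next
      case False
      then have none: "{y. y < x \<and> w x < w y} = {}"
        using x by blast
      show ?thesis
        unfolding i code_apply none by simp
    qed
  qed
  have "diagram (code w) \<subseteq> {..<N} \<times> {..<N}"
  proof
    fix c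
    assume "c \<in> diagram (code w)"
    then have "snd c < code w (fst c)"
      by (cases c) simp
    then show "c \<in> {..<N} \<times> {..<N}"
      using code[of "fst c"] by (cases c) (force simp: not_le[symmetric])
  qed
  then have "finite (diagram (code w))"
    by (rule finite_subset) simp
  moreover have "1 \<le> i" if "j < code w i" for i j
    using that code_0 by (cases i) auto
  ultimately show ?thesis
    by (auto simp: tower_diagram_def)
qed

text \<open>
  Before column \<open>m\<close>, the excess \<open>\<gamma> - m\<close> is the rank of \<open>\<alpha>\<close> among the values of
  \<open>inv w\<close> at the positions from \<open>m\<close> on.
\<close>

lemma slide_reaches_code:
  assumes "1 \<le> \<alpha>" "1 \<le> m" "m \<le> w \<alpha>" "m \<le> w (Suc \<alpha>)"
  shows "slide_reaches (code w) \<alpha> m (m + card {x. x < \<alpha> \<and> m \<le> w x})"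
  using assms(2,3,4)
proof (induction rule: dec_induct)
  case base
  have "1 \<le> w x \<longleftrightarrow> 1 \<le> x" for x
    using finite_permutation_eq[of x 0] by (auto simp: finite_permutation_0)
  then have "{x. x < \<alpha> \<and> 1 \<le> w x} = {x. x < \<alpha> \<and> 1 \<le> x}"
    by (simp only:)
  also have "\<dots> = {1..<\<alpha>}"
    by auto
  finally show ?case
    using assms slide_reaches.start[of "code w" \<alpha>] by simp
next
  case (step m)
  let ?A = "{x. x < \<alpha> \<and> m \<le> w x}" and ?B = "{x. x < \<alpha> \<and> Suc m \<le> w x}"
  obtain u where u: "m = w u"
    using finite_permutation_inv by metis
  have "u \<noteq> \<alpha>" "u \<noteq> Suc \<alpha>"
    using step u by auto
  \<comment> \<open>\<open>u\<close> is the position of the value \<open>m\<close>. If it lies left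
    of \<open>\<alpha>\<close>, the count drops by one while \<open>m\<close> grows, so the diagonal
    stays: a pass. If it lies right of \<open>Suc \<alpha>\<close>, the count stays and the diagonal
    moves up: a zigzag.\<close>
  then consider "u < \<alpha>" | "Suc \<alpha> < u"
    by linarith
  then show ?case
  proof cases
    case 1
    have "?A = insert u ?B"
      using 1 by (auto simp: u finite_permutation_eq Suc_le_eq order_le_less)
    then have card: "card ?A = Suc (card ?B)"
      by (simp add: u)
    have "code w m \<le> card ?B"
      unfolding u code_apply using 1 by (intro card_mono) auto
    then show ?thesis
      using slide_reaches.pass[of "code w" \<alpha> m "m + card ?A"] step card by simp
  next
    case 2
    have AB: "?A = ?B"
      using 2 by (auto simp: u finite_permutation_eq Suc_le_eq order_le_less)
    \<comment> \<open>Both \<open>\<alpha>\<close> and \<open>Suc \<alpha>\<close> form inversions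
      with \<open>u\<close>; these are the two extra cells that a zigzag requires.\<close>
    have "card (insert \<alpha> (insert (Suc \<alpha>) ?B)) \<le> code w m"
      unfolding u code_apply using 2 step.prems u by (intro card_mono) auto
    moreover have "card (insert \<alpha> (insert (Suc \<alpha>) ?B)) = card ?B + 2"
      by simp
    ultimately show ?thesis
      using slide_reaches.zigzag[of "code w" \<alpha> m "m + card ?A"] step AB by simp
  qed
qed

text \<open>At the column \<open>w \<alpha>\<close> the rank of \<open>\<alpha>\<close> equals the
  column height, so the slide arrives exactly at the first empty place.\<close>

lemma slide_reaches_code_ascent:
  assumes "1 \<le> \<alpha>" "w \<alpha> < w (Suc \<alpha>)"
  shows "slide_reaches (code w) \<alpha> (w \<alpha>) (code w (w \<alpha>) + w \<alpha>)"
proof -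
  have "1 \<le> w \<alpha>"
    using assms finite_permutation_eq[of \<alpha> 0] by (simp add: finite_permutation_0)
  moreover have "{x. x < \<alpha> \<and> w \<alpha> \<le> w x} = {x. x < \<alpha> \<and> w \<alpha> < w x}"
    by (auto simp: order_le_less finite_permutation_eq)
  ultimately show ?thesis
    using slide_reaches_code[of \<alpha> "w \<alpha>"] assms by (simp add: code_apply add.commute)
qed

text \<open>At the column \<open>w (Suc \<alpha>)\<close> position \<open>\<alpha>\<close>
  contributes one further inversion, so the column is one cell too high and case (b) occurs.\<close>

lemma slide_cell_code_descent:
  assumes "1 \<le> \<alpha>" "w (Suc \<alpha>) < w \<alpha>"
  shows "slide_cell \<alpha> (diagram (code w)) = None"
proof -
  let ?m = "w (Suc \<alpha>)" and ?B = "{x. x < \<alpha> \<and> w (Suc \<alpha>) < w x}"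
  have "1 \<le> ?m"
    using finite_permutation_eq[of "Suc \<alpha>" 0] by (simp add: finite_permutation_0)
  moreover have "{x. x < \<alpha> \<and> ?m \<le> w x} = ?B"
    by (auto simp: order_le_less finite_permutation_eq)
  ultimately have r: "slide_reaches (code w) \<alpha> ?m (?m + card ?B)"
    using slide_reaches_code[of \<alpha> ?m] assms by simp
  have "{x. x < Suc \<alpha> \<and> ?m < w x} = insert \<alpha> ?B"
    using assms by auto
  then have "code w ?m = Suc (card ?B)"
    by (simp add: code_apply)
  then show ?thesis
    by (simp add: slide_reaches_slide_from[OF r assms(1)] slide_from_hit)
qed

section \<open>Codes under multiplication by an adjacent transposition\<close>

lemma finite_permutation_comp_transpose:
  assumes "1 \<le> \<alpha>"
  shows "finite_permutation (w \<circ> transpose \<alpha> (Suc \<alpha>))"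
proof -
  have "transpose \<alpha> (Suc \<alpha>) permutes {1..}"
    using assms by (intro permutes_swap_id) auto
  moreover have "{x. (w \<circ> transpose \<alpha> (Suc \<alpha>)) x \<noteq> x} \<subseteq> {x. w x \<noteq> x} \<union> {\<alpha>, Suc \<alpha>}"
    by (auto simp: transpose_def)
  ultimately show ?thesis
    using w by (auto simp: finite_permutation_def intro: permutes_compose finite_subset)
qed

text \<open>Swapping an ascent creates a single new inversion, and its smaller value is
  \<open>w \<alpha>\<close>; only that column grows.\<close>

lemma code_comp_transpose:
  assumes "1 \<le> \<alpha>" "w \<alpha> < w (Suc \<alpha>)"
  shows "code (w \<circ> transpose \<alpha> (Suc \<alpha>)) = (code w)(w \<alpha> := Suc (code w (w \<alpha>)))"
proof
  fix i
  let ?s = "transpose \<alpha> (Suc \<alpha>)"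
  let ?w = "w \<circ> ?s"
  obtain u where u: "i = w u"
    using finite_permutation_inv by metis
  have bij: "bij ?w"
    using finite_permutation_bij by (simp add: bij_comp)
  have "inv ?w i = ?s u"
    using bij by (intro inv_f_eq) (auto simp: u bij_is_inj)
  then have code: "code ?w i = card {x. x < ?s u \<and> w u < w (?s x)}"
    by (simp add: code_def u)
  consider "u = \<alpha>" | "u = Suc \<alpha>" | "u < \<alpha>" | "Suc \<alpha> < u"
    by linarith
  then show "code ?w i = ((code w)(w \<alpha> := Suc (code w (w \<alpha>)))) i"
  proof cases
    case 1
    have "{x. x < Suc \<alpha> \<and> w \<alpha> < w (?s x)} = insert \<alpha> {x. x < \<alpha> \<and> w \<alpha> < w x}"
      using assms by (auto simp: transpose_def less_Suc_eq)
    then show ?thesis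
      unfolding code using 1 by (simp add: u code_apply)
  next
    case 2
    have "{x. x < \<alpha> \<and> w (Suc \<alpha>) < w (?s x)} = {x. x < Suc \<alpha> \<and> w (Suc \<alpha>) < w x}"
      using assms by (auto simp: transpose_def less_Suc_eq)
    then show ?thesis
      unfolding code using 2 assms by (simp add: u code_apply)
  next
    case 3
    have "{x. x < u \<and> w u < w (?s x)} = {x. x < u \<and> w u < w x}"
      using 3 by (auto simp: transpose_def)
    then show ?thesis
      unfolding code using 3 by (simp add: u code_apply finite_permutation_eq)
  next
    case 4
    \<comment> \<open>Both swapped positions lie left of \<open>u\<close>, so \<open>?s\<close>
      merely permutes the positions being counted.\<close>
    have "{x. x < u \<and> w u < w (?s x)} = ?s ` {x. x < u \<and> w u < w x}"
    proof (rule set_eqI)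
      fix x
      have "?s x < u \<longleftrightarrow> x < u"
        using 4 by (auto simp: transpose_def)
      then show "x \<in> {x. x < u \<and> w u < w (?s x)} \<longleftrightarrow> x \<in> ?s ` {x. x < u \<and> w u < w x}"
        using transpose_involutory[of \<alpha> "Suc \<alpha>"] by (auto simp: image_iff)
    qed
    then have "card {x. x < u \<and> w u < w (?s x)} = card {x. x < u \<and> w u < w x}"
      by (simp only: card_image[OF inj_on_transpose])
    then show ?thesis
      unfolding code using 4 by (simp add: u code_apply finite_permutation_eq)
  qed
qed

lemma diagram_code_ascent:
  assumes "1 \<le> \<alpha>" "w \<alpha> < w (Suc \<alpha>)"
  shows "diagram (code (w \<circ> transpose \<alpha> (Suc \<alpha>))) =
    insert (w \<alpha>, code w (w \<alpha>)) (diagram (code w))"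
  by (simp add: code_comp_transpose[OF assms] insert_diagram)

lemma card_diagram_code_ascent:
  assumes "1 \<le> \<alpha>" "w \<alpha> < w (Suc \<alpha>)"
  shows "card (diagram (code (w \<circ> transpose \<alpha> (Suc \<alpha>)))) = Suc (card (diagram (code w)))"
  using tower_diagram_code by (simp add: diagram_code_ascent[OF assms] tower_diagram_def)

end

text \<open>The swap turns the descent into an ascent and is an involution, so the ascent case is
  applied to the swapped permutation.\<close>

lemma card_diagram_code_descent:
  assumes w: "finite_permutation w" and "1 \<le> \<alpha>" "w (Suc \<alpha>) < w \<alpha>"
  shows "card (diagram (code w)) = Suc (card (diagram (code (w \<circ> transpose \<alpha> (Suc \<alpha>)))))"
proof -
  let ?w = "w \<circ> transpose \<alpha> (Suc \<alpha>)"
  have "finite_permutation ?w"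
    using assms by (intro finite_permutation_comp_transpose)
  from card_diagram_code_ascent[OF this, of \<alpha>] show ?thesis
    using assms by (simp add: comp_assoc)
qed

text \<open>\<open>inv w\<close> can be decoded value by value: \<open>inv w i\<close> is the
  position with exactly \<open>code w i\<close> positions below it that are not taken by values less
  than \<open>i\<close>.\<close>

lemma code_inj:
  assumes v: "finite_permutation v" and w: "finite_permutation w" and eq: "code v = code w"
  shows "v = w"
proof -
  \<comment> \<open>The positions below \<open>inv u i\<close> carry either smaller values or larger
    ones; the latter are counted by the code.\<close>
  have split: "inv u i = card {a \<in> inv u ` {..<i}. a < inv u i} + code u i"
    if u: "finite_permutation u" for u i
  proof -
    have im: "a \<in> inv u ` {..<i} \<longleftrightarrow> u a < i" for a
      using finite_permutation_inv[OF u] by (metis imageE imageI lessThan_iff)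
    have "i < u x" if "x < inv u i" "\<not> u x < i" for x
      using that finite_permutation_inv(1)[OF u, of x] by (cases "u x = i") auto
    then have "{..<inv u i} = {a \<in> inv u ` {..<i}. a < inv u i} \<union> {x. x < inv u i \<and> i < u x}"
      by (auto simp: im)
    moreover have "card ({a \<in> inv u ` {..<i}. a < inv u i} \<union> {x. x < inv u i \<and> i < u x}) =
        card {a \<in> inv u ` {..<i}. a < inv u i} + card {x. x < inv u i \<and> i < u x}"
      by (rule card_Un_disjoint) (auto simp: im)
    ultimately show ?thesis
      unfolding code_def by (metis card_lessThan)
  qed
  have inv_not_less: "\<not> inv u i < inv u' i"
    if u: "finite_permutation u" and u': "finite_permutation u'"
      and c: "code u = code u'" and im: "inv u ` {..<i} = inv u' ` {..<i}" for u u' i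
  proof
    assume less: "inv u i < inv u' i"
    let ?A = "inv u ` {..<i}"
    have notin: "inv u i \<notin> ?A"
      using finite_permutation_inv[OF u] by (metis imageE lessThan_iff less_irrefl)
    \<comment> \<open>Equal codes would require \<open>inv u' i - inv u i\<close> taken positions
      from \<open>inv u i\<close> up to below \<open>inv u' i\<close>, but \<open>inv u i\<close>
      itself is free.\<close>
    have "{a \<in> ?A. a < inv u' i} \<subseteq> {a \<in> ?A. a < inv u i} \<union> {inv u i<..<inv u' i}"
    proof
      fix a
      assume "a \<in> {a \<in> ?A. a < inv u' i}"
      then have "a \<in> ?A" "a < inv u' i" "a \<noteq> inv u i"
        using notin by blast+
      then show "a \<in> {a \<in> ?A. a < inv u i} \<union> {inv u i<..<inv u' i}"
        by (cases "a < inv u i") simp_all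
    qed
    then have "card {a \<in> ?A. a < inv u' i} \<le> card ({a \<in> ?A. a < inv u i} \<union> {inv u i<..<inv u' i})"
      by (intro card_mono) auto
    also have "\<dots> \<le> card {a \<in> ?A. a < inv u i} + (inv u' i - Suc (inv u i))"
      using card_Un_le[of "{a \<in> ?A. a < inv u i}" "{inv u i<..<inv u' i}"] by simp
    finally show False
      using split[OF u, of i] split[OF u', of i] c im less by simp
  qed
  have "inv v i = inv w i" for i
  proof (induction i rule: less_induct)
    case (less i)
    then have im: "inv v ` {..<i} = inv w ` {..<i}"
      by (intro image_cong) auto
    show ?case
      using inv_not_less[OF v w eq im] inv_not_less[OF w v eq[symmetric] im[symmetric]] by simp
  qed
  then have "inv v = inv w" ..
  then show ?thesis
    using finite_permutation_bij[OF v] finite_permutation_bij[OF w] inv_inv_eq by metis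
qed

subsection \<open>Reduced words\<close>

lemma finite_permutation_id: "finite_permutation id"
  by (simp add: finite_permutation_def permutes_id)

lemma diagram_code_id: "diagram (code id) = {}"
proof -
  have "code id i = 0" for i
    by (auto simp: code_def card_eq_0_iff)
  then show ?thesis
    by (simp add: diagram_def)
qed

lemma word_perm_Nil [simp]: "word_perm [] = id"
  by (simp add: word_perm_def)

lemma word_perm_snoc: "word_perm (\<alpha> @ [a]) = word_perm \<alpha> \<circ> transpose a (Suc a)"
proof -
  have "foldr (\<lambda>a p. transpose a (a + 1) \<circ> p) \<alpha> q = word_perm \<alpha> \<circ> q" for q
    by (induction \<alpha>) (simp_all add: word_perm_def comp_assoc)
  then show ?thesis
    by (simp add: word_perm_def)
qed

lemma finite_permutation_word_perm:
  "\<forall>a\<in>set \<alpha>. 1 \<le> a \<Longrightarrow> finite_permutation (word_perm \<alpha>)"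
  by (induction \<alpha> rule: rev_induct)
    (auto simp: word_perm_snoc finite_permutation_id intro!: finite_permutation_comp_transpose)

lemma ascent_or_descent:
  assumes "finite_permutation w"
  obtains "w \<alpha> < w (Suc \<alpha>)" | "w (Suc \<alpha>) < w \<alpha>"
  using finite_permutation_eq[OF assms, of \<alpha> "Suc \<alpha>"] by linarith

text \<open>Each letter changes the number of cells by one, up at an ascent and down at a
  descent.\<close>

lemma card_diagram_word_perm_le:
  "\<forall>a\<in>set \<alpha>. 1 \<le> a \<Longrightarrow> card (diagram (code (word_perm \<alpha>))) \<le> length \<alpha>"
proof (induction \<alpha> rule: rev_induct)
  case Nil
  show ?case
    unfolding word_perm_Nil diagram_code_id by simp
next
  case (snoc a \<alpha>)
  then have fp: "finite_permutation (word_perm \<alpha>)"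
    by (simp add: finite_permutation_word_perm)
  have a: "1 \<le> a" and IH: "card (diagram (code (word_perm \<alpha>))) \<le> length \<alpha>"
    using snoc by simp_all
  from IH have "card (diagram (code (word_perm \<alpha> \<circ> transpose a (Suc a)))) \<le> Suc (length \<alpha>)"
    using card_diagram_code_ascent[OF fp a] card_diagram_code_descent[OF fp a]
    by (cases rule: ascent_or_descent[OF fp, of a]) linarith+
  then show ?case
    unfolding word_perm_snoc length_append_singleton .
qed

text \<open>Both \<open>w\<close> and its inverse are strictly increasing, hence neither sends a
  number below itself.\<close>

lemma no_descent_imp_id:
  assumes w: "finite_permutation w" and asc: "\<And>a. 1 \<le> a \<Longrightarrow> w a < w (Suc a)"
  shows "w = id"
proof
  fix x
  \<comment> \<open>At \<open>a = 0\<close> this holds because \<open>w\<close> fixes 0 and is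
    injective.\<close>
  have "w a < w (Suc a)" for a
    using asc[of a] finite_permutation_eq[OF w, of 1 0]
    by (cases a) (auto simp: finite_permutation_0[OF w])
  then have mono: "strict_mono w"
    by (simp add: strict_mono_Suc_iff)
  then have "strict_mono (inv w)"
    using finite_permutation_inv[OF w] by (metis strict_mono_def strict_mono_less)
  then have "x \<le> w x" "w x \<le> inv w (w x)"
    using mono by (auto intro: strict_mono_imp_increasing)
  then show "w x = id x"
    by (simp add: finite_permutation_inv[OF w])
qed

text \<open>Sorting by descents: each swap removes one cell and supplies the last letter of the
  word.\<close>

lemma ex_word_of:
  assumes "finite_permutation w"
  shows "\<exists>\<alpha>. word_of w \<alpha> \<and> length \<alpha> = card (diagram (code w))"
  using assms
proof (induction "card (diagram (code w))" arbitrary: w rule: less_induct)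
  case less
  show ?case
  proof (cases "\<exists>a\<ge>1. w (Suc a) < w a")
    case True
    then obtain a where a: "1 \<le> a" "w (Suc a) < w a"
      by blast
    let ?s = "transpose a (Suc a)"
    have "card (diagram (code w)) = Suc (card (diagram (code (w \<circ> ?s))))"
      using card_diagram_code_descent[OF less.prems a] .
    moreover from this obtain \<alpha> where
      "word_of (w \<circ> ?s) \<alpha>" "length \<alpha> = card (diagram (code (w \<circ> ?s)))"
      using less.hyps[of "w \<circ> ?s"] finite_permutation_comp_transpose[OF less.prems a(1)] by auto
    ultimately show ?thesis
      using a(1) by (intro exI[of _ "\<alpha> @ [a]"]) (auto simp: word_of_def word_perm_snoc comp_assoc)
  next
    case False
    then have "w = id"
      using less.prems ascent_or_descent by (intro no_descent_imp_id) blast+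
    then show ?thesis
      by (intro exI[of _ "[]"]) (simp add: word_of_def diagram_code_id)
  qed
qed

text \<open>The number of cells bounds the length of every word from below and is attained.\<close>

lemma Red_iff:
  assumes "finite_permutation w"
  shows "\<alpha> \<in> Red w \<longleftrightarrow> word_of w \<alpha> \<and> length \<alpha> = card (diagram (code w))"
proof -
  have ge: "card (diagram (code w)) \<le> length \<beta>" if "word_of w \<beta>" for \<beta>
    using that card_diagram_word_perm_le[of \<beta>] by (auto simp: word_of_def)
  obtain \<beta> where "word_of w \<beta>" "length \<beta> = card (diagram (code w))"
    using ex_word_of[OF assms] by blast
  then show ?thesis
    using ge by (auto simp: Red_def intro!: antisym) metis
qed

subsection \<open>Standard tower tableaux\<close>

lemma STT_range:
  assumes "f \<in> STT T" "f c = Some b"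
  shows "1 \<le> b" "b \<le> card T"
proof -
  have "c \<in> T" "bij_betw (\<lambda>c. the (f c)) T {1..card T}"
    using assms by (auto simp: STT_def)
  then have "the (f c) \<in> {1..card T}"
    by (rule bij_betwE[THEN bspec, rotated])
  then show "1 \<le> b" "b \<le> card T"
    using assms by auto
qed

lemma STT_finite: "f \<in> STT T \<Longrightarrow> finite T"
  by (auto simp: STT_def dest: bij_betw_finite)

lemma STT_empty: "f \<in> STT {} \<longleftrightarrow> f = Map.empty"
  by (auto simp: STT_def bij_betw_def)

lemma cells_upto_upd:
  "d \<notin> dom g \<Longrightarrow> a \<le> n \<Longrightarrow> cells_upto (g(d \<mapsto> Suc n)) a = cells_upto g a"
  by (auto simp: cells_upto_def split: if_splits)

lemma cells_upto_all:
  assumes "\<And>c b. g c = Some b \<Longrightarrow> 1 \<le> b \<and> b \<le> n"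
  shows "cells_upto g n = dom g"
  using assms by (fastforce simp: cells_upto_def)

lemma cell_at_upd:
  "d \<notin> dom g \<Longrightarrow> a \<le> n \<Longrightarrow> cell_at (g(d \<mapsto> Suc n)) a = cell_at g a"
  unfolding cell_at_def by (rule arg_cong[where f = The]) (auto split: if_splits)

lemma cell_at_upd_last:
  assumes "\<And>c b. g c = Some b \<Longrightarrow> b \<le> n"
  shows "cell_at (g(d \<mapsto> Suc n)) (Suc n) = d"
  unfolding cell_at_def using assms by (intro the_equality) (fastforce split: if_splits)+

text \<open>The conditions on the earlier labels concern \<open>g\<close> alone, so only those on
  the last cell are new. One direction grows a tableau along the SR algorithm, the other removes its
  largest label.\<close>

lemma STT_upd_iff:
  assumes d: "d \<notin> dom g" and S: "finite (dom g)"
    and g: "\<And>c b. g c = Some b \<Longrightarrow> 1 \<le> b \<and> b \<le> card (dom g)"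
  shows "g(d \<mapsto> Suc (card (dom g))) \<in> STT (insert d (dom g)) \<longleftrightarrow>
    g \<in> STT (dom g) \<and> tower_diagram (insert d (dom g)) \<and> corner_cell (insert d (dom g)) d"
proof -
  define n where "n = card (dom g)"
  let ?f = "g(d \<mapsto> Suc n)"
  have "card (insert d (dom g)) = Suc n"
    using d S by (simp add: n_def)
  moreover have "bij_betw (\<lambda>c. the (?f c)) (insert d (dom g)) {1..Suc n} \<longleftrightarrow>
      bij_betw (\<lambda>c. the (g c)) (dom g) {1..n}"
  proof -
    have "bij_betw (\<lambda>c. the (?f c)) (insert d (dom g)) {1..Suc n} \<longleftrightarrow>
        bij_betw (\<lambda>c. the (?f c)) (dom g \<union> {d}) ({1..n} \<union> {the (?f d)})"
      by (simp add: atLeastAtMostSuc_conv)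
    also have "\<dots> \<longleftrightarrow> bij_betw (\<lambda>c. the (?f c)) (dom g) {1..n}"
      using d by (intro notIn_Un_bij_betw3[symmetric]) auto
    also have "\<dots> \<longleftrightarrow> bij_betw (\<lambda>c. the (g c)) (dom g) {1..n}"
      using d by (intro bij_betw_cong) auto
    finally show ?thesis .
  qed
  moreover have "cells_upto ?f (Suc n) = insert d (dom g)"
    using g by (subst cells_upto_all) (auto simp: n_def le_Suc_eq split: if_splits)
  moreover have "cell_at ?f (Suc n) = d"
    using g by (intro cell_at_upd_last) (auto simp: n_def)
  ultimately show ?thesis
    unfolding n_def[symmetric] STT_def
    using d by (auto simp: cells_upto_upd cell_at_upd domIff atLeastAtMostSuc_conv simp flip: n_def)
qed

lemma Read_upd:
  assumes g: "g \<in> STT (dom g)" and d: "d \<notin> dom g"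
  shows "Read (g(d \<mapsto> Suc (card (dom g)))) = Read g @ [flight_number (insert d (dom g)) d]"
proof -
  define n where "n = card (dom g)"
  let ?f = "g(d \<mapsto> Suc n)"
  have range: "1 \<le> b \<and> b \<le> n" if "g c = Some b" for c b
    using STT_range[OF g that] by (simp add: n_def)
  have "card (dom ?f) = Suc n"
    using d STT_finite[OF g] by (simp add: n_def)
  moreover have "cells_upto ?f (Suc n) = insert d (dom g)"
    using range by (subst cells_upto_all) (auto simp: le_Suc_eq split: if_splits)
  moreover have "cell_at ?f (Suc n) = d"
    using range by (intro cell_at_upd_last) auto
  ultimately show ?thesis
    unfolding Read_def n_def[symmetric]
    using d by (auto simp: cells_upto_upd cell_at_upd domIff simp flip: n_def)
qed

lemma STT_decompose:
  assumes f: "f \<in> STT T" and "T \<noteq> {}"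
  obtains g d where "d \<notin> dom g" "T = insert d (dom g)" "f = g(d \<mapsto> Suc (card (dom g)))"
    "g \<in> STT (dom g)" "tower_diagram T" "corner_cell T d"
proof -
  have fin: "finite T"
    using STT_finite[OF f] .
  have dom: "dom f = T" and bij: "bij_betw (\<lambda>c. the (f c)) T {1..card T}"
    using f by (auto simp: STT_def)
  have "card T \<in> {1..card T}"
    using fin assms(2) by (simp add: Suc_le_eq card_gt_0_iff)
  then obtain d where d: "d \<in> T" "the (f d) = card T"
    using bij by (metis (no_types, lifting) bij_betw_imp_surj_on imageE)
  define g where "g = f(d := None)"
  have dg: "d \<notin> dom g" and T: "T = insert d (dom g)"
    using d dom by (auto simp: g_def)
  then have card: "card T = Suc (card (dom g))"
    using fin by (metis card_insert_disjoint finite_insert)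
  then have fg: "f = g(d \<mapsto> Suc (card (dom g)))"
    using d dom by (auto simp: g_def)
  \<comment> \<open>By injectivity no cell other than \<open>d\<close> carries the label
    \<open>card T\<close>.\<close>
  have range: "1 \<le> b \<and> b \<le> card (dom g)" if "g c = Some b" for c b
  proof -
    have c: "f c = Some b" "c \<noteq> d" "c \<in> T"
      using that dom by (auto simp: g_def split: if_splits)
    then have "the (f c) \<noteq> the (f d)"
      using inj_onD[OF bij_betw_imp_inj_on[OF bij], of c d] d(1) by blast
    then show ?thesis
      using STT_range[OF f c(1)] c d card by simp
  qed
  have "finite (dom g)"
    using fin T by (metis finite_insert)
  then have "g \<in> STT (dom g) \<and> tower_diagram T \<and> corner_cell T d"
    using STT_upd_iff[OF dg _ range] f fg T by simp
  then show thesis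
    using that dg T fg by blast
qed

subsection \<open>The SR algorithm and the reading map\<close>

text \<open>The recursion consumes the word from the left; exposing the last letter matches the
  removal of the largest label.\<close>

lemma SR_from_snoc:
  "SR_from f k (\<alpha> @ [a]) =
    (case SR_from f k \<alpha> of
       None \<Rightarrow> None
     | Some g \<Rightarrow>
        (case slide_cell a (dom g) of None \<Rightarrow> None | Some d \<Rightarrow> Some (g(d \<mapsto> k + length \<alpha>))))"
  by (induction \<alpha> arbitrary: f k) (auto split: option.splits)

lemma recording_tableau_snoc:
  "recording_tableau \<alpha> = Some g \<Longrightarrow> slide_cell a (dom g) = Some d \<Longrightarrow>
    recording_tableau (\<alpha> @ [a]) = Some (g(d \<mapsto> Suc (length \<alpha>)))"
  by (simp add: recording_tableau_def SR_from_snoc)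

lemma recording_tableau_snocD:
  assumes "recording_tableau (\<alpha> @ [a]) = Some f"
  obtains g d where "recording_tableau \<alpha> = Some g" "slide_cell a (dom g) = Some d"
    "f = g(d \<mapsto> Suc (length \<alpha>))"
  using assms by (auto simp: recording_tableau_def SR_from_snoc split: option.splits)

lemma length_Read: "length (Read f) = card (dom f)"
  by (simp add: Read_def)

text \<open>Once the cell with the largest label is removed, \<open>corner_cell_slide\<close> says
  that sliding its flight number puts it back.\<close>

lemma recording_tableau_Read:
  assumes "f \<in> STT T"
  shows "recording_tableau (Read f) = Some f \<and> (\<forall>a\<in>set (Read f). 1 \<le> a)"
  using assms
proof (induction "card T" arbitrary: f T)
  case 0
  then have "f = Map.empty"
    using STT_finite STT_empty by fastforce
  then show ?case
    by (simp add: Read_def recording_tableau_def)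
next
  case (Suc n)
  then have "T \<noteq> {}" by auto
  from Suc.prems this show ?case
  proof (rule STT_decompose)
    fix g d
    assume *: "d \<notin> dom g" "T = insert d (dom g)" "f = g(d \<mapsto> Suc (card (dom g)))"
      "g \<in> STT (dom g)" "tower_diagram T" "corner_cell T d"
    have "n = card (dom g)"
      using Suc * STT_finite[of g "dom g"] by simp
    then have IH: "recording_tableau (Read g) = Some g \<and> (\<forall>a\<in>set (Read g). 1 \<le> a)"
      using Suc.hyps(1) *(4) by blast
    have "T - {d} = dom g"
      using * by auto
    then have sl: "1 \<le> flight_number T d" "slide_cell (flight_number T d) (dom g) = Some d"
      using corner_cell_slide[OF *(5,6)] by auto
    have rd: "Read f = Read g @ [flight_number T d]"
      using Read_upd[OF *(4,1)] *(2,3) by simp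
    then show ?thesis
      using recording_tableau_snoc[OF conjunct1[OF IH] sl(2)] sl(1) IH *(3) by (simp add: length_Read)
  qed
qed

text \<open>A slide that yields a cell forces an ascent, and then \<open>slide_reaches_top\<close>
  identifies the new cell as a corner whose flight number is the letter. The claims are proved
  together because the step needs the shape of \<open>g\<close> as a code.\<close>

lemma recording_tableau_Some:
  assumes "recording_tableau \<alpha> = Some f" "\<forall>a\<in>set \<alpha>. 1 \<le> a"
  shows "f \<in> STT (dom f) \<and> Read f = \<alpha> \<and> dom f = diagram (code (word_perm \<alpha>))"
  using assms
proof (induction \<alpha> arbitrary: f rule: rev_induct)
  case Nil
  then show ?case
    unfolding word_perm_Nil diagram_code_id
    by (auto simp: recording_tableau_def STT_empty Read_def)
next
  case (snoc a \<alpha>)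
  let ?w = "word_perm \<alpha>"
  obtain g d where g: "recording_tableau \<alpha> = Some g" "slide_cell a (dom g) = Some d"
    "f = g(d \<mapsto> Suc (length \<alpha>))"
    using snoc.prems(1) by (rule recording_tableau_snocD)
  have IH: "g \<in> STT (dom g)" "Read g = \<alpha>" "dom g = diagram (code ?w)"
    using snoc.IH[OF g(1)] snoc.prems by auto
  have w: "finite_permutation ?w" and a: "1 \<le> a"
    using snoc.prems by (auto intro: finite_permutation_word_perm)
  have asc: "?w a < ?w (Suc a)"
    using slide_cell_code_descent[OF w a] g(2) IH(3)
    by (cases rule: ascent_or_descent[OF w, of a]) auto
  note top = slide_reaches_top[OF slide_reaches_code_ascent[OF w a asc] a code_0[OF w]]
  have d: "d = (?w a, code ?w (?w a))"
    using g(2) top(1) IH(3) by simp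
  have dg: "d \<notin> dom g"
    by (simp add: d IH(3))
  have len: "length \<alpha> = card (dom g)"
    using length_Read[of g] IH(2) by simp
  have dgm: "insert d (dom g) = diagram (code (word_perm (\<alpha> @ [a])))"
    by (simp add: word_perm_snoc diagram_code_ascent[OF w a asc] d IH(3))
  have "tower_diagram (insert d (dom g))"
    unfolding dgm using snoc.prems by (intro tower_diagram_code finite_permutation_word_perm)
  moreover have "corner_cell (insert d (dom g)) d" and fl: "flight_number (insert d (dom g)) d = a"
    using top(2,3) by (simp_all add: d IH(3))
  moreover have "1 \<le> b \<and> b \<le> card (dom g)" if "g c = Some b" for c b
    using STT_range[OF IH(1) that] by simp
  ultimately have "f \<in> STT (insert d (dom g))"
    using STT_upd_iff[OF dg STT_finite[OF IH(1)]] IH(1) unfolding g(3) len by blast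
  moreover have "Read f = \<alpha> @ [a]"
    unfolding g(3) len Read_upd[OF IH(1) dg] fl IH(2) ..
  moreover have "dom f = insert d (dom g)"
    unfolding g(3) by auto
  ultimately show ?case
    using dgm by metis
qed

lemma recording_tableau_reduced:
  assumes "\<forall>a\<in>set \<alpha>. 1 \<le> a" "length \<alpha> = card (diagram (code (word_perm \<alpha>)))"
  shows "\<exists>f. recording_tableau \<alpha> = Some f"
  using assms
proof (induction \<alpha> rule: rev_induct)
  case Nil
  then show ?case by (simp add: recording_tableau_def)
next
  case (snoc a \<alpha>)
  let ?w = "word_perm \<alpha>"
  have w: "finite_permutation ?w" and a: "1 \<le> a" and pos: "\<forall>a\<in>set \<alpha>. 1 \<le> a"
    using snoc.prems by (auto intro: finite_permutation_word_perm)
  have le: "card (diagram (code ?w)) \<le> length \<alpha>"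
    using pos by (rule card_diagram_word_perm_le)
  have len: "Suc (length \<alpha>) = card (diagram (code (?w \<circ> transpose a (Suc a))))"
    using snoc.prems(2) unfolding word_perm_snoc length_append_singleton .
  \<comment> \<open>At a descent the prefix would have two cells more than letters, against
    \<open>le\<close>.\<close>
  have asc: "?w a < ?w (Suc a)"
    using card_diagram_code_descent[OF w a] le len
    by (cases rule: ascent_or_descent[OF w, of a]) auto
  then have "length \<alpha> = card (diagram (code ?w))"
    using card_diagram_code_ascent[OF w a] len by simp
  then obtain g where g: "recording_tableau \<alpha> = Some g"
    using snoc.IH pos by blast
  then have "dom g = diagram (code ?w)"
    using recording_tableau_Some pos by blast
  then have "slide_cell a (dom g) = Some (?w a, code ?w (?w a))"
    using slide_reaches_top(1)[OF slide_reaches_code_ascent[OF w a asc] a code_0[OF w]] by simp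
  then show ?case
    using recording_tableau_snoc[OF g] by blast
qed

theorem theorem4p4:
  fixes w :: "nat \<Rightarrow> nat"
  assumes "finite_permutation w"
  shows "bij_betw Read (STT (tower_diagram_of w)) (Red w)
    \<and> (\<forall>\<alpha>\<in>Red w. recording_tableau \<alpha> = Some (inv_into (STT (tower_diagram_of w)) Read \<alpha>))"
proof -
  let ?T = "diagram (code w)"
  have sr: "\<exists>f\<in>STT ?T. recording_tableau \<alpha> = Some f \<and> Read f = \<alpha>" if "\<alpha> \<in> Red w" for \<alpha>
  proof -
    have \<alpha>: "\<forall>a\<in>set \<alpha>. 1 \<le> a" "word_perm \<alpha> = w" "length \<alpha> = card ?T"
      using that Red_iff[OF assms] by (auto simp: word_of_def)
    then obtain f where "recording_tableau \<alpha> = Some f"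
      using recording_tableau_reduced by blast
    then show ?thesis
      using recording_tableau_Some[OF _ \<alpha>(1)] \<alpha>(2) by auto
  qed
  have "Red w \<noteq> {}"
    using ex_word_of[OF assms] Red_iff[OF assms] by blast
  then have "(SOME \<alpha>. \<alpha> \<in> Red w) \<in> Red w"
    by (simp add: some_in_eq)
  from sr[OF this] obtain f where
    "f \<in> STT ?T" "recording_tableau (SOME \<alpha>. \<alpha> \<in> Red w) = Some f"
    by blast
  \<comment> \<open>By \<open>sr\<close> every reduced word has this shape, so the arbitrary choice
    is harmless.\<close>
  then have T: "tower_diagram_of w = ?T"
    by (simp add: tower_diagram_of_def STT_def)
  \<comment> \<open>The SR algorithm rebuilds \<open>f\<close> from its reading word, so that word's
    permutation has the same diagram as \<open>w\<close> and therefore equals \<open>w\<close>. The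
    word is reduced because its length is the number of cells.\<close>
  have read: "Read f \<in> Red w" if "f \<in> STT ?T" for f
  proof -
    have dom: "dom f = ?T"
      using that by (simp add: STT_def)
    have rt: "recording_tableau (Read f) = Some f" and pos: "\<forall>a\<in>set (Read f). 1 \<le> a"
      using recording_tableau_Read[OF that] by auto
    have "diagram (code (word_perm (Read f))) = diagram (code w)"
      using recording_tableau_Some[OF rt pos] dom by simp
    then have "code (word_perm (Read f)) i = code w i" for i
      by (metis mem_diagram linorder_neqE_nat less_irrefl)
    then have "code (word_perm (Read f)) = code w" ..
    then have "word_perm (Read f) = w"
      by (rule code_inj[OF finite_permutation_word_perm[OF pos] assms])
    then show ?thesis
      using pos dom by (simp add: Red_iff[OF assms] word_of_def length_Read)
  qed
  have inj: "inj_on Read (STT ?T)"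
    by (rule inj_onI) (metis recording_tableau_Read option.inject)
  have "Read ` STT ?T = Red w"
    using read sr by force
  with inj have "bij_betw Read (STT ?T) (Red w)"
    by (simp add: bij_betw_def)
  moreover have "recording_tableau \<alpha> = Some (inv_into (STT ?T) Read \<alpha>)" if "\<alpha> \<in> Red w" for \<alpha>
    using sr[OF that] inv_into_f_f[OF inj] by auto
  ultimately show ?thesis
    by (simp add: T)
qed

end
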